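(* Let $G=(V,E,c)$ be an undirected graph without isolated nodes and with node weights $c:V\to\mathbb{N}_{>0}$, and let $U \ge 2\,\frac{c(V)}{|V|}$ be a maximal cluster weight. Let $\mathscr{C}$ be a clustering of $V$ obtained by size-constrained label propagation followed by 2-hop clustering with maximal cluster weight $U$ (as described in the context). Then \[ |\mathscr{C}| \le \frac{1}{2}|V| + \frac{c(V)}{U}. \]
   Context: For $V'\subseteq V$ write $c(V')=\sum_{v\in V'}c(v)$. A clustering is a partition of $V$ into nonempty sets (clusters); a cluster $K$ is adjacent to a node $v\notin K$ (or to a cluster containing $v$) if some node of $K$ is a neighbor of $v$. Size-constrained label propagation with maximal cluster weight $U$ refers to any clustering procedure forming clusters of adjacent nodes under a weight constraint $U$ with the following essential property: in the resulting clustering, a node $v$ never forms a singleton cluster as long as there is any adjacent cluster $K$ with $c(K)+c(v)\le U$. 2-hop clustering is then applied: each singleton cluster $S=\{v\}$ (with $v$ non-isolated) is assigned a favorite cluster $K_S$ among the clusters adjacent to $S$, and singleton clusters with the same favorite cluster are merged with each other as long as this does not violate the weight constraint (merged weight at most $U$). $\mathscr{C}$ denotes the final clustering after both steps. *)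

theory Defs
  imports Complex_Main "HOL-Library.Disjoint_Sets"
begin

definition ugraph :: "'a set \<Rightarrow> 'a set set \<Rightarrow> bool" where
  "ugraph V E \<longleftrightarrow> finite V \<and> (\<forall>e\<in>E. e \<subseteq> V \<and> card e = 2)"

definition isolated :: "'a set set \<Rightarrow> 'a \<Rightarrow> bool" where
  "isolated E v \<longleftrightarrow> (\<forall>u. {u, v} \<notin> E)"

definition weight :: "('a \<Rightarrow> nat) \<Rightarrow> 'a set \<Rightarrow> nat" where
  "weight c K = (\<Sum>v\<in>K. c v)"

definition adjacent :: "'a set set \<Rightarrow> 'a set \<Rightarrow> 'a \<Rightarrow> bool" where
  "adjacent E K v \<longleftrightarrow> v \<notin> K \<and> (\<exists>u\<in>K. {u, v} \<in> E)"

text \<open>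
  Clusters of adjacent nodes are formed by propagating labels: every node starts with its own
  label, and in each round every node either keeps its label or takes over the current label of
  a neighbour. The rule for choosing is left open, and the nodes changing their label in a round
  may be a single one (sequential variants) or many (synchronous variants).
\<close>

inductive propagated_labels :: "'a set \<Rightarrow> 'a set set \<Rightarrow> ('a \<Rightarrow> 'a) \<Rightarrow> bool"
  for V :: "'a set" and E :: "'a set set" where
  start: "propagated_labels V E (\<lambda>v. v)"
| round: "propagated_labels V E l \<Longrightarrow>
    (\<forall>v\<in>V. l' v = l v \<or> (\<exists>u\<in>V. {u, v} \<in> E \<and> l' v = l u)) \<Longrightarrow>
    propagated_labels V E l'"

definition label_clusters :: "'a set \<Rightarrow> ('a \<Rightarrow> 'a) \<Rightarrow> 'a set set" where
  "label_clusters V l = (\<lambda>x. {v \<in> V. l v = x}) ` (l ` V)"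

lemma partition_on_label_clusters: "partition_on V (label_clusters V l)"
  by (rule partition_onI) (auto simp: label_clusters_def disjnt_def)

text \<open>
  A single node may be heavier than \<open>U\<close>, so the weight constraint concerns only clusters formed
  from several nodes. It is required of the result, not of the intermediate labellings.
\<close>

definition size_constrained_lp ::
  "'a set \<Rightarrow> 'a set set \<Rightarrow> ('a \<Rightarrow> nat) \<Rightarrow> real \<Rightarrow> 'a set set \<Rightarrow> bool" where
  "size_constrained_lp V E c U C \<longleftrightarrow>
     (\<exists>l. propagated_labels V E l \<and> C = label_clusters V l) \<and>
     (\<forall>K\<in>C. card K \<ge> 2 \<longrightarrow> real (weight c K) \<le> U) \<and>
     (\<forall>v. {v} \<in> C \<longrightarrow> \<not> (\<exists>K\<in>C. adjacent E K v \<and> real (weight c K + c v) \<le> U))"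

definition singletons :: "'a set set \<Rightarrow> 'a set set \<Rightarrow> 'a set set" where
  "singletons E C = {S \<in> C. \<exists>v. S = {v} \<and> \<not> isolated E v}"

definition favorites :: "'a set set \<Rightarrow> 'a set set \<Rightarrow> ('a set \<Rightarrow> 'a set) \<Rightarrow> bool" where
  "favorites E C fav \<longleftrightarrow>
     (\<forall>S \<in> singletons E C. fav S \<in> C \<and> (\<exists>v\<in>S. adjacent E (fav S) v))"

text \<open>
  One merge: \<open>C\<^sub>0\<close> is the clustering before 2-hop clustering, \<open>C\<close> and \<open>C'\<close> are the clusterings
  before and after the merge. Favourites always refer to \<open>C\<^sub>0\<close>; the merged clusters \<open>A\<close> and \<open>B\<close>
  are singletons of \<open>C\<^sub>0\<close> or unions of such singletons arising from earlier merges.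
\<close>

definition two_hop_merge ::
  "'a set set \<Rightarrow> ('a \<Rightarrow> nat) \<Rightarrow> real \<Rightarrow> 'a set set \<Rightarrow> ('a set \<Rightarrow> 'a set) \<Rightarrow>
   'a set set \<Rightarrow> 'a set set \<Rightarrow> bool" where
  "two_hop_merge E c U C\<^sub>0 fav C C' \<longleftrightarrow>
     (\<exists>A\<in>C. \<exists>B\<in>C. \<exists>K\<in>C\<^sub>0. A \<noteq> B \<and>
        A \<union> B \<subseteq> \<Union>{S \<in> singletons E C\<^sub>0. fav S = K} \<and>
        real (weight c (A \<union> B)) \<le> U \<and>
        C' = insert (A \<union> B) (C - {A, B}))"

definition two_hop_clustering ::
  "'a set set \<Rightarrow> ('a \<Rightarrow> nat) \<Rightarrow> real \<Rightarrow> 'a set set \<Rightarrow> 'a set set \<Rightarrow> bool" where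
  "two_hop_clustering E c U C\<^sub>0 C \<longleftrightarrow>
     (\<exists>fav. favorites E C\<^sub>0 fav \<and> (two_hop_merge E c U C\<^sub>0 fav)\<^sup>*\<^sup>* C\<^sub>0 C \<and>
        \<not> (\<exists>C'. two_hop_merge E c U C\<^sub>0 fav C C'))"

end

theory Submission
  imports Defs
begin

text \<open>
  Every cluster that is not a singleton has at least two nodes, so it suffices to show that the
  number \<open>s\<close> of final singletons satisfies \<open>s * U \<le> 2 * c(V)\<close>. Call a final singleton light if its
  weight is at most \<open>U / 2\<close>. Two light singletons cannot share a favourite, since otherwise they
  would have been merged, and a light singleton and its favourite together weigh more than \<open>U\<close>,
  since otherwise label propagation would have joined them. Hence the favourites of the light
  singletons are pairwise distinct clusters, none of them light, and each compensates for the
  weight that its light singleton lacks.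
\<close>

lemma weight_singleton [simp]: "weight c {v} = c v"
  by (simp add: weight_def)

lemma sum_weight_partition:
  assumes "partition_on V P" "finite V"
  shows "(\<Sum>K\<in>P. weight c K) = weight c V"
proof -
  have "\<forall>K\<in>P. finite K"
    using assms by (auto simp: partition_on_def intro: finite_subset[OF Sup_upper])
  moreover have "\<forall>K\<in>P. \<forall>L\<in>P. K \<noteq> L \<longrightarrow> K \<inter> L = {}"
    using assms(1) by (auto simp: partition_on_def disjoint_def)
  ultimately show ?thesis
    using sum.Union_disjoint[of P c] partition_onD1[OF assms(1)] by (simp add: weight_def)
qed

text \<open>A part has at least two nodes unless it is a singleton, which falls short of 2 by
  exactly one; summing over the parts gives the bound.\<close>

lemma card_partition_le_singletons:
  assumes P: "partition_on V P" and V: "finite V"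
  shows "2 * card P \<le> card V + card {v. {v} \<in> P}"
proof -
  let ?S = "{K \<in> P. card K = 1}"
  have finP: "finite P"
    using finite_elements[OF V P] .
  have "2 \<le> card K + (if card K = 1 then 1 else 0)" if "K \<in> P" for K
  proof -
    have "K \<noteq> {}" "finite K"
      using that P V by (auto simp: partition_on_def intro: finite_subset)
    then show ?thesis
      using card_0_eq[of K] by (cases "card K") auto
  qed
  then have "(\<Sum>K\<in>P. 2) \<le> (\<Sum>K\<in>P. card K + (if card K = 1 then 1 else 0))"
    by (rule sum_mono)
  also have "\<dots> = (\<Sum>K\<in>P. card K) + card ?S"
    using finP by (simp add: sum.distrib sum.If_cases Collect_conj_eq)
  also have "(\<Sum>K\<in>P. card K) = card V"
    using sum_weight_partition[OF P V, of "\<lambda>_. 1"] by (simp add: weight_def)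
  also have "?S = (\<lambda>v. {v}) ` {v. {v} \<in> P}"
    by (auto simp: card_1_singleton_iff)
  also have "card \<dots> = card {v. {v} \<in> P}"
    by (simp add: card_image)
  finally show ?thesis
    by simp
qed

text \<open>A discharging argument: each singleton from \<open>T\<close> is charged \<open>U\<close>
  against twice its weight, and the deficit of a light one is covered by the surplus of its
  favourite \<open>f v\<close>.\<close>

lemma card_singletons_times_weight_bound:
  fixes U :: real
  assumes V: "finite V" and P: "partition_on V P"
    and T: "\<And>v. v \<in> T \<Longrightarrow> {v} \<in> P"
    and f: "\<And>v. v \<in> T \<Longrightarrow> f v \<in> P"
    and heavy: "\<And>v. v \<in> T \<Longrightarrow> real (weight c (f v) + c v) > U"
    and pairs: "\<And>v w. v \<in> T \<Longrightarrow> w \<in> T \<Longrightarrow> v \<noteq> w \<Longrightarrow> f v = f w \<Longrightarrow> real (c v + c w) > U"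
  shows "real (card T) * U \<le> 2 * real (weight c V)"
proof -
  define A where "A = (\<lambda>v. {v}) ` T"
  define L where "L = {v \<in> T. 2 * real (c v) \<le> U}"
  define Ls where "Ls = (\<lambda>v. {v}) ` L"
  \<comment> \<open>twice the weight of a cluster minus the \<open>U\<close> charged to it if it is a singleton of \<open>T\<close>\<close>
  define g where "g K = 2 * real (weight c K) - (if K \<in> A then U else 0)" for K
  have finP: "finite P"
    using finite_elements[OF V P] .
  have AP: "A \<subseteq> P"
    using T by (auto simp: A_def)
  have sub: "Ls \<union> f ` L \<subseteq> P"
    using T f by (auto simp: Ls_def L_def)
  \<comment> \<open>If the favourite of a light \<open>v\<close> were a light singleton, their
    weights would sum to at most \<open>U\<close>, contradicting \<open>heavy\<close>.\<close>
  have disj: "Ls \<inter> f ` L = {}"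
  proof -
    have "f v \<noteq> {u}" if "u \<in> L" "v \<in> L" for u v
      using heavy[of v] that by (auto simp: L_def)
    then show ?thesis
      by (force simp: Ls_def)
  qed
  have inj: "inj_on f L"
  proof (rule inj_onI)
    fix v w assume "v \<in> L" "w \<in> L" "f v = f w"
    then show "v = w"
      using pairs[of v w] by (force simp: L_def)
  qed
  \<comment> \<open>Such a part is either not charged or a singleton heavier than
    \<open>U / 2\<close>.\<close>
  have rest: "g K \<ge> 0" if "K \<in> P - (Ls \<union> f ` L)" for K
    using that by (auto simp: g_def A_def Ls_def L_def)
  have "0 \<le> (\<Sum>v\<in>L. g {v} + g (f v))"
  proof (rule sum_nonneg)
    fix v assume "v \<in> L"
    then have "v \<in> T" "{v} \<in> A" "2 * real (c v) \<le> U"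
      by (auto simp: L_def A_def)
    \<comment> \<open>By \<open>heavy\<close>, the pair contributes more than \<open>2 * U\<close>
      before charges. Two charges use up at most that; if \<open>f v\<close> is not charged, what
      remains exceeds \<open>U\<close>, so the sign of \<open>U\<close> matters.\<close>
    moreover from this have "U \<ge> 0"
      by linarith
    ultimately show "0 \<le> g {v} + g (f v)"
      using heavy[of v] by (auto simp: g_def)
  qed
  also have "\<dots> = (\<Sum>K\<in>Ls. g K) + (\<Sum>K\<in>f ` L. g K)"
    by (simp add: Ls_def sum.distrib sum.reindex inj)
  also have "\<dots> = (\<Sum>K\<in>Ls \<union> f ` L. g K)"
    using sub finP disj by (intro sum.union_disjoint[symmetric]) (auto intro: finite_subset)
  also have "\<dots> \<le> (\<Sum>K\<in>P. g K)"
    using finP sub rest by (intro sum_mono2) auto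
  also have "\<dots> = 2 * real (\<Sum>K\<in>P. weight c K) - (\<Sum>K\<in>P. if K \<in> A then U else 0)"
    by (simp add: g_def sum_subtractf sum_distrib_left)
  also have "(\<Sum>K\<in>P. if K \<in> A then U else 0) = real (card A) * U"
    using finP AP by (simp add: sum.If_cases Int_absorb1)
  also have "card A = card T"
    by (simp add: A_def card_image)
  finally show ?thesis
    by (simp add: sum_weight_partition[OF P V])
qed

lemma two_hop_merge_partition_on:
  assumes P: "partition_on V C" and m: "two_hop_merge E c U C\<^sub>0 fav C C'"
  shows "partition_on V C'"
proof -
  obtain A B where AB: "A \<in> C" "B \<in> C" "A \<noteq> B" and C': "C' = insert (A \<union> B) (C - {A, B})"
    using m by (auto simp: two_hop_merge_def)
  have dis: "\<And>K L. K \<in> C \<Longrightarrow> L \<in> C \<Longrightarrow> K \<noteq> L \<Longrightarrow> K \<inter> L = {}"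
    using P by (auto simp: partition_on_def disjoint_def)
  show ?thesis
  proof (rule partition_onI)
    show "\<Union>C' = V"
      using AB P by (auto simp: C' partition_on_def)
    show "{} \<notin> C'"
      using AB P by (auto simp: C' partition_on_def)
    have new: "disjnt (A \<union> B) L" if "L \<in> C - {A, B}" for L
      using that AB dis[of A L] dis[of B L] unfolding disjnt_def Int_Un_distrib2 by blast
    show "disjnt K L" if "K \<in> C'" "L \<in> C'" "K \<noteq> L" for K L
      using that new[of K] new[of L] dis[of K L]
      unfolding C' by (metis Diff_iff disjnt_def disjnt_sym insert_iff)
  qed
qed

text \<open>Two distinct nonempty sets never have a singleton as their union, so merging creates no
  new singletons.\<close>

lemma two_hop_merge_singleton:
  assumes P: "partition_on V C" and m: "two_hop_merge E c U C\<^sub>0 fav C C'" and v: "{v} \<in> C'"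
  shows "{v} \<in> C"
proof -
  obtain A B where AB: "A \<in> C" "B \<in> C" "A \<noteq> B" and C': "C' = insert (A \<union> B) (C - {A, B})"
    using m by (auto simp: two_hop_merge_def)
  have "A \<noteq> {}" "B \<noteq> {}"
    using AB P by (auto simp: partition_on_def)
  then have "A \<union> B \<noteq> {v}"
    using AB(3) by (auto simp: Un_singleton_iff)
  then show ?thesis
    using v C' by auto
qed

lemma two_hop_merges_invariant:
  assumes "(two_hop_merge E c U C\<^sub>0 fav)\<^sup>*\<^sup>* C\<^sub>0 C" and "partition_on V C\<^sub>0"
  shows "partition_on V C \<and> (\<forall>v. {v} \<in> C \<longrightarrow> {v} \<in> C\<^sub>0)"
  using assms
proof (induction rule: rtranclp_induct)
  case base
  then show ?case by simp
next
  case (step C C')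
  then show ?case
    using two_hop_merge_partition_on two_hop_merge_singleton by metis
qed

theorem theorem1:
  fixes V :: "'a set" and E :: "'a set set" and c :: "'a \<Rightarrow> nat" and U :: real
    and C\<^sub>0 C :: "'a set set"
  assumes "ugraph V E"
    and "\<forall>v\<in>V. \<not> isolated E v"
    and "\<forall>v\<in>V. c v > 0"
    and "U \<ge> 2 * (real (weight c V) / real (card V))"
    and "size_constrained_lp V E c U C\<^sub>0"
    and "two_hop_clustering E c U C\<^sub>0 C"
  shows "real (card C) \<le> 1 / 2 * real (card V) + real (weight c V) / U"
proof -
  have V: "finite V"
    using assms(1) by (simp add: ugraph_def)
  have P0: "partition_on V C\<^sub>0"
    using assms(5) by (auto simp: size_constrained_lp_def partition_on_label_clusters)
  obtain fav where fav: "favorites E C\<^sub>0 fav"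
    and steps: "(two_hop_merge E c U C\<^sub>0 fav)\<^sup>*\<^sup>* C\<^sub>0 C"
    and final: "\<nexists>C'. two_hop_merge E c U C\<^sub>0 fav C C'"
    using assms(6) by (auto simp: two_hop_clustering_def)
  have P: "partition_on V C" and C0: "\<And>v. {v} \<in> C \<Longrightarrow> {v} \<in> C\<^sub>0"
    using two_hop_merges_invariant[OF steps P0] by auto
  define T where "T = {v. {v} \<in> C}"
  have sing: "{v} \<in> singletons E C\<^sub>0" if "v \<in> T" for v
  proof -
    have "v \<in> V"
      using that P by (auto simp: T_def partition_on_def)
    then show ?thesis
      using that assms(2) C0 by (auto simp: T_def singletons_def)
  qed
  have favC: "fav {v} \<in> C\<^sub>0" and adj: "adjacent E (fav {v}) v" if "v \<in> T" for v
    using fav sing[OF that] by (auto simp: favorites_def)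
  have bound: "real (card T) * U \<le> 2 * real (weight c V)"
  \<comment> \<open>The final singletons are counted inside the initial partition
    \<open>C\<^sub>0\<close>: favourites and the label propagation property refer to it, and a
    favourite may no longer be a part of \<open>C\<close>.\<close>
  proof (rule card_singletons_times_weight_bound[OF V P0, where f = "\<lambda>v. fav {v}"])
    fix v assume v: "v \<in> T"
    show "{v} \<in> C\<^sub>0"
      using v C0 by (simp add: T_def)
    then show "real (weight c (fav {v}) + c v) > U"
      using assms(5) favC[OF v] adj[OF v] unfolding size_constrained_lp_def by (meson not_le)
    show "fav {v} \<in> C\<^sub>0"
      using favC[OF v] .
  next
    fix v w assume vw: "v \<in> T" "w \<in> T" "v \<noteq> w" "fav {v} = fav {w}"
    show "real (c v + c w) > U"
    proof (rule ccontr)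
      assume "\<not> ?thesis"
      then have "real (weight c ({v} \<union> {w})) \<le> U"
        using vw(3) by (simp add: weight_def)
      moreover have "{v} \<union> {w} \<subseteq> \<Union>{S \<in> singletons E C\<^sub>0. fav S = fav {v}}"
        using sing[OF vw(1)] sing[OF vw(2)] vw(4) by auto
      ultimately have "two_hop_merge E c U C\<^sub>0 fav C (insert ({v} \<union> {w}) (C - {{v}, {w}}))"
        unfolding two_hop_merge_def using vw favC[OF vw(1)]
        by (intro bexI[of _ "{v}"] bexI[of _ "{w}"] bexI[of _ "fav {v}"]) (auto simp: T_def)
      then show False
        using final by blast
    qed
  qed
  have count: "2 * card C \<le> card V + card T"
    using card_partition_le_singletons[OF P V] by (simp add: T_def)
  show ?thesis
  \<comment> \<open>For empty \<open>V\<close> the lower bound on \<open>U\<close> reads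
    \<open>0 / 0 = 0\<close> and so admits \<open>U = 0\<close>; otherwise it makes \<open>U\<close>
    positive, which permits dividing by \<open>U\<close>.\<close>
  proof (cases "V = {}")
    case True
    then have "C = {}"
      using P by (simp add: partition_on_empty)
    with True show ?thesis
      by (simp add: weight_def)
  next
    case False
    then have "weight c V > 0"
      using V assms(3) by (auto simp: weight_def intro!: sum_pos)
    then have "U > 0"
      using assms(4) V False
      by (smt (verit) card_gt_0_iff divide_pos_pos of_nat_0_less_iff)
    then have "real (card T) \<le> 2 * (real (weight c V) / U)"
      using bound by (simp add: field_simps)
    then show ?thesis
      using count by linarith
  qed
qed

end
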